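(* Let $\Omega$ be a disk in $\mathcal{F}$ and for each $n\ge1$ let $f_n:\Omega\to\mathcal{F}$ be a scaling map with scaling ratio $q^{\lambda_n}$, where $(\lambda_n)$ is a strictly increasing sequence of integers. Then $$\dim_{\mathcal H}\{x\in\Omega:([f_n(x)]_0)_{n\ge1}\text{ is not uniformly distributed in }\mathcal{O}/\mathfrak{p}\}=1,$$ and consequently $$\dim_{\mathcal H}\{x\in\Omega:([f_n(x)])_{n\ge1}\text{ is not uniformly distributed in }\mathcal{O}\}=1.$$
   Context: $\mathcal{F}$ is a non-Archimedean local field with valuation ring $\mathcal{O}$, maximal ideal $\mathfrak{p}$, $q=\#\mathcal{O}/\mathfrak{p}$, normalized absolute value $|\cdot|_\mathfrak{p}$, prime element $\pi$. Fix representatives $C\subset\mathcal{O}$ of $\mathcal{O}/\mathfrak{p}$ with $0\in C$; writing $x=\sum_{n\ge v}c_n\pi^n$ ($c_n\in C$), $[x]=\sum_{n\ge0}c_n\pi^n$ and $[x]_0=c_0$ (the $0$-digit). A disk is $D(a,r)=\{x:|x-a|_\mathfrak{p}\le r\}$. A map $f:\Omega\to\mathcal{F}$ is scaling with ratio $q^\lambda$ if $|f(x)-f(y)|_\mathfrak{p}=q^\lambda|x-y|_\mathfrak{p}$ for all $x,y\in\Omega$. A sequence with values in a finite set of $m$ symbols (here $C\cong\mathcal{O}/\mathfrak{p}$, $m=q$) is uniformly distributed if each symbol occurs with asymptotic frequency $1/m$. A sequence $(x_n)\subset\mathcal{O}$ is uniformly distributed in $\mathcal{O}$ if for all $a\in\mathcal{O}$,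 $k\in\mathbb{N}$, $\frac1N\#\{1\le n\le N:x_n\in D(a,q^{-k})\}\to q^{-k}$. Hausdorff dimension is with respect to the metric $|x-y|_\mathfrak{p}$. *)

theory Defs
  imports "HOL-Analysis.Analysis"
begin

definition valring :: "('a::field \<Rightarrow> real) \<Rightarrow> 'a set" where
  "valring absv = {x. absv x \<le> 1}"

definition residue_rel :: "('a::field \<Rightarrow> real) \<Rightarrow> ('a \<times> 'a) set" where
  "residue_rel absv = {(x, y). x \<in> valring absv \<and> y \<in> valring absv \<and> absv (x - y) < 1}"

definition nonarch_local_field :: "('a::field \<Rightarrow> real) \<Rightarrow> nat \<Rightarrow> 'a \<Rightarrow> bool" where
  "nonarch_local_field absv q prm \<longleftrightarrow>
     (\<forall>x. absv x \<ge> 0) \<and> (\<forall>x. absv x = 0 \<longleftrightarrow> x = 0) \<and>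
     (\<forall>x y. absv (x * y) = absv x * absv y) \<and>
     (\<forall>x y. absv (x + y) \<le> max (absv x) (absv y)) \<and>
     (\<forall>x. x \<noteq> 0 \<longrightarrow> (\<exists>k::int. absv x = real q powr real_of_int k)) \<and>
     absv prm = 1 / real q \<and>
     finite (valring absv // residue_rel absv) \<and> card (valring absv // residue_rel absv) = q \<and>
     (\<forall>X::nat \<Rightarrow> 'a. (\<forall>e>0. \<exists>N. \<forall>m\<ge>N. \<forall>n\<ge>N. absv (X m - X n) < e) \<longrightarrow>
        (\<exists>L. (\<lambda>n. absv (X n - L)) \<longlonglongrightarrow> 0))"

definition residue_reps :: "('a::field \<Rightarrow> real) \<Rightarrow> 'a set \<Rightarrow> bool" where
  "residue_reps absv C \<longleftrightarrow> C \<subseteq> valring absv \<and> 0 \<in> C \<and>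
     (\<forall>x\<in>valring absv. \<exists>!c. c \<in> C \<and> absv (x - c) < 1)"

definition is_expansion :: "('a::field \<Rightarrow> real) \<Rightarrow> nat \<Rightarrow> 'a \<Rightarrow> 'a set \<Rightarrow> 'a \<Rightarrow> (int \<Rightarrow> 'a) \<Rightarrow> bool" where
  "is_expansion absv q prm C x c \<longleftrightarrow> (\<forall>n. c n \<in> C) \<and>
     (\<exists>N. (\<forall>n<N. c n = 0) \<and>
        (\<forall>M. absv (x - (\<Sum>k\<in>{N..M}. c k * prm powi k)) \<le> real q powr (- real_of_int (M + 1))))"

definition digit :: "('a::field \<Rightarrow> real) \<Rightarrow> nat \<Rightarrow> 'a \<Rightarrow> 'a set \<Rightarrow> 'a \<Rightarrow> int \<Rightarrow> 'a" where
  "digit absv q prm C x = (THE c. is_expansion absv q prm C x c)"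

definition digit0 :: "('a::field \<Rightarrow> real) \<Rightarrow> nat \<Rightarrow> 'a \<Rightarrow> 'a set \<Rightarrow> 'a \<Rightarrow> 'a" where
  "digit0 absv q prm C x = digit absv q prm C x 0"

text \<open>[x] = sum_{n>=0} c_n prm^n, i.e. x minus its (finite) fractional part.\<close>
definition intpart :: "('a::field \<Rightarrow> real) \<Rightarrow> nat \<Rightarrow> 'a \<Rightarrow> 'a set \<Rightarrow> 'a \<Rightarrow> 'a" where
  "intpart absv q prm C x = x -
     (\<Sum>k\<in>{k. k < 0 \<and> digit absv q prm C x k \<noteq> 0}. digit absv q prm C x k * prm powi k)"

definition disk :: "('a::field \<Rightarrow> real) \<Rightarrow> 'a \<Rightarrow> real \<Rightarrow> 'a set" where
  "disk absv a r = {x. absv (x - a) \<le> r}"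

definition scaling_map :: "('a::field \<Rightarrow> real) \<Rightarrow> nat \<Rightarrow> 'a set \<Rightarrow> ('a \<Rightarrow> 'a) \<Rightarrow> int \<Rightarrow> bool" where
  "scaling_map absv q \<Omega> f lam \<longleftrightarrow>
     (\<forall>x\<in>\<Omega>. \<forall>y\<in>\<Omega>. absv (f x - f y) = real q powr real_of_int lam * absv (x - y))"

definition ud_symbols :: "'b set \<Rightarrow> (nat \<Rightarrow> 'b) \<Rightarrow> bool" where
  "ud_symbols C s \<longleftrightarrow> (\<forall>c\<in>C.
     (\<lambda>N. real (card {n\<in>{1..N}. s n = c}) / real N) \<longlonglongrightarrow> 1 / real (card C))"

definition ud_valring :: "('a::field \<Rightarrow> real) \<Rightarrow> nat \<Rightarrow> (nat \<Rightarrow> 'a) \<Rightarrow> bool" where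
  "ud_valring absv q s \<longleftrightarrow> (\<forall>a\<in>valring absv. \<forall>k::nat.
     (\<lambda>N. real (card {n\<in>{1..N}. s n \<in> disk absv a (real q powr (- real k))}) / real N)
       \<longlonglongrightarrow> real q powr (- real k))"

definition adiam :: "('a::field \<Rightarrow> real) \<Rightarrow> 'a set \<Rightarrow> real" where
  "adiam absv U = (if U = {} then 0 else Sup {absv (x - y) | x y. x \<in> U \<and> y \<in> U})"

definition hausdorff_pre :: "('a::field \<Rightarrow> real) \<Rightarrow> real \<Rightarrow> real \<Rightarrow> 'a set \<Rightarrow> ennreal" where
  "hausdorff_pre absv s \<delta> E = (INF U \<in> {U :: nat \<Rightarrow> 'a set. E \<subseteq> (\<Union>i. U i) \<and>
       (\<forall>i. bdd_above {absv (x - y) | x y. x \<in> U i \<and> y \<in> U i} \<and> adiam absv (U i) \<le> \<delta>)}.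
     (\<Sum>i. ennreal (adiam absv (U i) powr s)))"

definition hausdorff_measure :: "('a::field \<Rightarrow> real) \<Rightarrow> real \<Rightarrow> 'a set \<Rightarrow> ennreal" where
  "hausdorff_measure absv s E = (SUP \<delta> \<in> {0<..}. hausdorff_pre absv s \<delta> E)"

definition hausdorff_dim :: "('a::field \<Rightarrow> real) \<Rightarrow> 'a set \<Rightarrow> ereal" where
  "hausdorff_dim absv E = (INF s \<in> {s. s > 0 \<and> hausdorff_measure absv s E = 0}. ereal s)"

end

theory Submission
  imports Defs
begin

text \<open>
  Choose a family of scaling maps h_j of ratio q^j, for j \<ge> R, with h_j = f_n whenever j = lam n. The
  digits digit0 (h_j x) are then coordinates identifying the disk of radius q^(-R) with the
  sequences over C, and the distance of two points is determined by the first coordinate in which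
  they differ. Given a large L, prescribe one symbol at every L-th of the coordinates
  lam n and fill the remaining coordinates with the base q digits of a real t in [0,1).
  Doing this with two different prescribed symbols yields two points whose sequences have
  frequencies of the symbol 0 that differ by 1/L, so at least one of them is not uniformly distributed.
  Since t is a Hoelder function of exponent s \<le> 1 - 1/L of either point, an economical cover of
  the exceptional set would yield one of [0,1), so its s-dimensional Hausdorff measure is positive.
\<close>

section \<open>The absolute value and the residue representatives\<close>

locale local_field_digits =
  fixes absv :: "'a::field \<Rightarrow> real" and q :: nat and prm :: 'a and C :: "'a set"
  assumes nonarch: "nonarch_local_field absv q prm" and reps: "residue_reps absv C"
begin

lemma absv_nonneg [simp]: "absv x \<ge> 0"
  and absv_eq_0_iff [simp]: "absv x = 0 \<longleftrightarrow> x = 0"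
  and absv_mult: "absv (x * y) = absv x * absv y"
  and absv_add_le: "absv (x + y) \<le> max (absv x) (absv y)"
  and absv_prm: "absv prm = 1 / real q"
  and absv_powr: "x \<noteq> 0 \<Longrightarrow> \<exists>k::int. absv x = real q powr real_of_int k"
  and finite_residue_classes: "finite (valring absv // residue_rel absv)"
  and card_residue_classes: "card (valring absv // residue_rel absv) = q"
  using nonarch unfolding nonarch_local_field_def by (elim conjE; simp; fail)+

lemma absv_0 [simp]: "absv 0 = 0"
  by simp

lemma absv_complete:
  assumes "\<And>e. e > 0 \<Longrightarrow> \<exists>N. \<forall>m\<ge>N. \<forall>n\<ge>N. absv (X m - X n) < e"
  shows "\<exists>L. (\<lambda>n::nat. absv (X n - L)) \<longlonglongrightarrow> 0"
  using nonarch assms unfolding nonarch_local_field_def by (elim conjE) simp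

lemma absv_1 [simp]: "absv 1 = 1"
  using absv_mult[of 1 1] by simp

lemma absv_minus [simp]: "absv (- x) = absv x"
proof -
  have "absv (- 1) * absv (- 1) = 1"
    using absv_mult[of "- 1" "- 1"] by simp
  hence "absv (- 1) = 1"
    using absv_nonneg[of "- 1"] by (auto simp: square_eq_1_iff)
  thus ?thesis
    by (metis absv_mult mult_1 mult_minus1)
qed

lemma absv_minus_commute: "absv (x - y) = absv (y - x)"
  by (metis absv_minus minus_diff_eq)

lemma absv_diff_triangle: "absv (x - z) \<le> max (absv (x - y)) (absv (y - z))"
  using absv_add_le[of "x - y" "y - z"] by simp

lemma absv_diff_le_trans: "absv (x - y) \<le> b \<Longrightarrow> absv (y - z) \<le> b \<Longrightarrow> absv (x - z) \<le> b"
  using absv_diff_triangle[of x z y] by simp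

lemma C_le_1: "c \<in> C \<Longrightarrow> absv c \<le> 1"
  and zero_in_C: "0 \<in> C"
  using reps by (auto simp: residue_reps_def valring_def)

lemma ex1_rep: "absv x \<le> 1 \<Longrightarrow> \<exists>!c. c \<in> C \<and> absv (x - c) < 1"
  using reps by (auto simp: residue_reps_def valring_def)

lemma C_eqI: "c \<in> C \<Longrightarrow> d \<in> C \<Longrightarrow> absv (c - d) < 1 \<Longrightarrow> c = d"
  using ex1_rep[of c] C_le_1[of c] by auto

lemma residue_rel_equiv: "equiv (valring absv) (residue_rel absv)"
proof (rule equivI)
  show "trans (residue_rel absv)"
  proof (rule transI)
    fix x y z assume "(x, y) \<in> residue_rel absv" "(y, z) \<in> residue_rel absv"
    thus "(x, z) \<in> residue_rel absv"
      using absv_diff_triangle[of x z y] by (auto simp: residue_rel_def)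
  qed
qed (auto simp: residue_rel_def refl_on_def valring_def sym_def absv_minus_commute)

text \<open>Carries finiteness and the cardinality \<open>q\<close>, which are assumed for the
  quotient of residue classes, over to \<open>C\<close>.\<close>

lemma bij_residue_classes:
  "bij_betw (\<lambda>c. residue_rel absv `` {c}) C (valring absv // residue_rel absv)"
  unfolding bij_betw_def
proof (intro conjI inj_onI equalityI subsetI)
  fix c d assume cd: "c \<in> C" "d \<in> C" "residue_rel absv `` {c} = residue_rel absv `` {d}"
  have "(c, d) \<in> residue_rel absv"
    using cd eq_equiv_class[OF cd(3) residue_rel_equiv] C_le_1 by (auto simp: valring_def)
  thus "c = d"
    using cd C_eqI by (auto simp: residue_rel_def)
next
  fix K assume "K \<in> valring absv // residue_rel absv"
  then obtain x where x: "absv x \<le> 1" "K = residue_rel absv `` {x}"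
    by (auto simp: quotient_def valring_def)
  obtain c where c: "c \<in> C" "absv (x - c) < 1"
    using ex1_rep[OF x(1)] by auto
  have "(x, c) \<in> residue_rel absv"
    using x c C_le_1 by (auto simp: residue_rel_def valring_def)
  hence "K = residue_rel absv `` {c}"
    using x equiv_class_eq[OF residue_rel_equiv] by auto
  thus "K \<in> (\<lambda>c. residue_rel absv `` {c}) ` C"
    using c by auto
qed (auto simp: quotient_def dest!: C_le_1 simp: valring_def)

lemma card_C: "card C = q" and finite_C: "finite C"
proof -
  show "card C = q" "finite C"
    using finite_residue_classes card_residue_classes
      bij_betw_same_card[OF bij_residue_classes] bij_betw_finite[OF bij_residue_classes]
    by auto
qed

lemma ex_nonzero_in_C: "\<exists>c\<in>C. c \<noteq> 0"
  using ex1_rep[of 1] by (metis absv_1 diff_zero less_irrefl order_refl)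

text \<open>The representative of the class of 1 cannot be 0, so \<open>C\<close> has at least two
  elements.\<close>

lemma q_gt_1: "q > 1"
proof -
  obtain c where c: "c \<in> C" "c \<noteq> 0"
    using ex_nonzero_in_C by auto
  have "card {0, c} \<le> card C"
    using c zero_in_C finite_C by (intro card_mono) auto
  thus ?thesis
    using c card_C by simp
qed

lemma q_pos [simp]: "q > 0" "Suc 0 < q" "Suc 0 \<le> q" "real q > 1" "real q \<ge> 1" "real q > 0" "q \<noteq> 0"
  using q_gt_1 by auto

lemma prm_nonzero [simp]: "prm \<noteq> 0"
  by (metis absv_0 absv_prm divide_eq_0_iff of_nat_0_eq_iff q_pos(1) less_irrefl zero_neq_one)

lemma absv_power: "absv (x ^ n) = absv x ^ n"
  by (induction n) (auto simp: absv_mult)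

lemma absv_inverse: "absv (inverse x) = inverse (absv x)"
proof (cases "x = 0")
  case False
  thus ?thesis
    using absv_mult[of x "inverse x"] by (simp add: field_simps)
qed simp

lemma absv_prm_powi: "absv (prm powi k) = real q powi (- k)"
  by (auto simp: power_int_def absv_power absv_inverse absv_prm power_one_over inverse_eq_divide[symmetric]
      power_inverse[symmetric])

lemma powr_eq_powi: "real q powr real_of_int k = real q powi k"
  by (simp add: powr_real_of_int')

lemma powr_minus_eq_powi: "real q powr (- real_of_int k) = real q powi (- k)"
  using powr_eq_powi[of "- k"] by simp

text \<open>All nonzero values are integral powers of \<open>q\<close>, so a strict bound by one
  power improves to the next smaller power.\<close>

lemma absv_discrete:
  assumes "absv x < real q powi k"
  shows "absv x \<le> real q powi (k - 1)"
proof (cases "x = 0")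
  case False
  then obtain i :: int where i: "absv x = real q powi i"
    using absv_powr by (auto simp: powr_eq_powi)
  hence "i < k"
    using assms power_int_increasing[of k i "real q"] by (cases "i < k") auto
  thus ?thesis
    unfolding i by (intro power_int_increasing) auto
qed auto

lemma C_diff: "c \<in> C \<Longrightarrow> d \<in> C \<Longrightarrow> c \<noteq> d \<Longrightarrow> absv (c - d) = 1"
  using C_eqI[of c d] absv_add_le[of c "- d"] C_le_1[of c] C_le_1[of d] by fastforce

lemma C_eqI':
  assumes "c \<in> C" "d \<in> C" "absv ((c - d) * prm powi k) < real q powi (- k)"
  shows "c = d"
proof (rule ccontr)
  assume "c \<noteq> d"
  thus False
    using assms C_diff by (simp add: absv_mult absv_prm_powi)
qed

lemma ex_powi_ge: "\<exists>k::int. real q powi k \<ge> x"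
proof -
  obtain n where "x < real q ^ n"
    using real_arch_pow[of "real q" x] by auto
  thus ?thesis
    by (intro exI[of _ "int n"]) auto
qed

lemma ex_powi_le: "x > 0 \<Longrightarrow> \<exists>k::int. real q powi k \<le> x"
proof -
  assume "x > 0"
  obtain k where "real q powi k \<ge> inverse x"
    using ex_powi_ge by blast
  hence "real q powi (- k) \<le> x"
    using \<open>x > 0\<close> unfolding power_int_minus
    by (metis inverse_inverse_eq le_imp_inverse_le positive_imp_inverse_positive)
  thus ?thesis by blast
qed

section \<open>Expansions and digits\<close>

lemma is_expansion_iff:
  "is_expansion absv q prm C x c \<longleftrightarrow> (\<forall>n. c n \<in> C) \<and>
     (\<exists>N. (\<forall>n<N. c n = 0) \<and>
        (\<forall>M. absv (x - (\<Sum>k\<in>{N..M}. c k * prm powi k)) \<le> real q powi (- (M + 1))))"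
  unfolding is_expansion_def powr_minus_eq_powi by (rule refl)

text \<open>Terms below the start vanish, so the start may be lowered. This allows two expansions to
  be compared from a common start.\<close>

lemma is_expansion_start:
  assumes "is_expansion absv q prm C x c"
  shows "\<exists>N. (\<forall>n<N. c n = 0) \<and> (\<forall>N'\<le>N. \<forall>M.
    absv (x - (\<Sum>k\<in>{N'..M}. c k * prm powi k)) \<le> real q powi (- (M + 1)))"
proof -
  obtain N where N: "\<forall>n<N. c n = 0"
    "\<forall>M. absv (x - (\<Sum>k\<in>{N..M}. c k * prm powi k)) \<le> real q powi (- (M + 1))"
    using assms unfolding is_expansion_iff by blast
  have "(\<Sum>k\<in>{N'..M}. c k * prm powi k) = (\<Sum>k\<in>{N..M}. c k * prm powi k)" if "N' \<le> N" for N' M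
    using that N(1) by (intro sum.mono_neutral_right) auto
  hence "absv (x - (\<Sum>k\<in>{N'..M}. c k * prm powi k)) \<le> real q powi (- (M + 1))" if "N' \<le> N" for N' M
    using N(2) that by metis
  thus ?thesis
    using N(1) by blast
qed

lemma is_expansion_in_C: "is_expansion absv q prm C x c \<Longrightarrow> c n \<in> C"
  by (simp add: is_expansion_def)

text \<open>If the digits below \<open>j\<close> agree, the partial sums up to \<open>j - 1\<close>
  coincide and lie within q^(-j) of both points. Conversely, at the first place \<open>i\<close>
  where the digits could differ, the partial sums differ by \<open>(c i - d i) * prm powi i\<close>,
  which has absolute value q^(-i) unless the digits are equal, while closeness of the points allows
  only q^(-(i + 1)).\<close>

lemma expansion_agree_iff:
  assumes "is_expansion absv q prm C x c" "is_expansion absv q prm C y d"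
  shows "(\<forall>i<j. c i = d i) \<longleftrightarrow> absv (x - y) \<le> real q powi (- j)"
proof -
  obtain N1 where N1: "\<forall>n<N1. c n = 0" "\<forall>N'\<le>N1. \<forall>M.
      absv (x - (\<Sum>k\<in>{N'..M}. c k * prm powi k)) \<le> real q powi (- (M + 1))"
    using is_expansion_start[OF assms(1)] by blast
  obtain N2 where N2: "\<forall>n<N2. d n = 0" "\<forall>N'\<le>N2. \<forall>M.
      absv (y - (\<Sum>k\<in>{N'..M}. d k * prm powi k)) \<le> real q powi (- (M + 1))"
    using is_expansion_start[OF assms(2)] by blast
  define N where "N = min N1 N2"
  define S where "S c M = (\<Sum>k\<in>{N..M}. c k * prm powi k)" for c :: "int \<Rightarrow> 'a" and M
  have S: "absv (x - S c M) \<le> real q powi (- (M + 1))" "absv (y - S d M) \<le> real q powi (- (M + 1))" for M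
    using N1 N2 by (auto simp: S_def N_def)
  show ?thesis
  proof
    assume "\<forall>i<j. c i = d i"
    hence "S c (j - 1) = S d (j - 1)"
      unfolding S_def by (intro sum.cong) auto
    thus "absv (x - y) \<le> real q powi (- j)"
      using S[of "j - 1"] absv_diff_le_trans[of x "S c (j - 1)" _ y] absv_minus_commute by auto
  next
    assume le: "absv (x - y) \<le> real q powi (- j)"
    have low: "c i = d i" if "i < N" for i
      using N1(1) N2(1) that by (auto simp: N_def)
    have "N + int n < j \<Longrightarrow> c (N + int n) = d (N + int n)" for n
    proof (induction n rule: less_induct)
      case (less n)
      define i where "i = N + int n"
      have "c k = d k" if "k < i" "k \<ge> N" for k
        using less(1)[of "nat (k - N)"] less(2) that by (auto simp: i_def)
      hence eq: "(\<Sum>k\<in>{N..i-1}. c k * prm powi k) = (\<Sum>k\<in>{N..i-1}. d k * prm powi k)"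
        by (intro sum.cong) auto
      have ins: "{N..i} = insert i {N..i-1}"
        by (auto simp: i_def)
      have "S c i - S d i = (c i - d i) * prm powi i"
        unfolding S_def ins using eq by (simp add: algebra_simps)
      moreover have "absv (x - y) \<le> real q powi (- (i + 1))"
        using le by (rule order_trans) (use less(2) in \<open>auto intro!: power_int_increasing simp: i_def\<close>)
      hence "absv (S c i - S d i) \<le> real q powi (- (i + 1))"
        using S[of i] absv_diff_le_trans absv_minus_commute by metis
      moreover have "real q powi (- (i + 1)) < real q powi (- i)"
        by (intro power_int_strict_increasing) auto
      ultimately show "c (N + int n) = d (N + int n)"
        using assms is_expansion_in_C C_eqI'[of "c i" "d i" i] unfolding i_def by fastforce
    qed
    from this[of "nat (_ - N)"] show "\<forall>i<j. c i = d i"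
      using low by (metis add.commute diff_add_cancel int_nat_eq not_less diff_ge_0_iff_ge)
  qed
qed

lemma ex_expansion: "\<exists>c. is_expansion absv q prm C x c"
proof -
  obtain K where K: "absv x \<le> real q powi K"
    using ex_powi_ge by blast
  define N where "N = - K"
  \<comment> \<open>Once \<open>x\<close> is rescaled into the valuation ring, digits are read off
    by repeatedly subtracting the representative and dividing by \<open>prm\<close>. The remainders
    \<open>rs n\<close> stay in the valuation ring because each difference has absolute value at
    most 1/q by \<open>absv_discrete\<close>.\<close>
  define rep where "rep y = (THE c. c \<in> C \<and> absv (y - c) < 1)" for y
  have rep: "rep y \<in> C \<and> absv (y - rep y) < 1" if "absv y \<le> 1" for y
    unfolding rep_def using ex1_rep[OF that] by (rule theI')
  define rs where "rs = rec_nat (x * prm powi (- N)) (\<lambda>_ y. (y - rep y) / prm)"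
  have rs_0: "rs 0 = x * prm powi (- N)" and rs_Suc: "rs (Suc n) = (rs n - rep (rs n)) / prm" for n
    by (auto simp: rs_def)
  have rs_le: "absv (rs n) \<le> 1" for n
  proof (induction n)
    case 0
    have "absv x * real q powi N \<le> real q powi K * real q powi N"
      using K by (intro mult_right_mono) auto
    also have "\<dots> = 1"
      by (simp add: N_def power_int_minus)
    finally show ?case
      by (simp add: rs_0 absv_mult absv_prm_powi)
  next
    case (Suc n)
    have "absv (rs n - rep (rs n)) \<le> real q powi (0 - 1)"
      using rep[OF Suc] by (intro absv_discrete) auto
    hence "absv (rs n - rep (rs n)) * real q \<le> inverse (real q) * real q"
      by (intro mult_right_mono) simp_all
    thus ?case
      by (simp add: rs_Suc divide_inverse absv_mult absv_inverse absv_prm)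
  qed
  define c where "c k = (if k < N then 0 else rep (rs (nat (k - N))))" for k
  have sum: "x = (\<Sum>k\<in>{N..N + int n - 1}. c k * prm powi k) + rs n * prm powi (N + int n)" for n
  proof (induction n)
    case 0
    thus ?case
      by (simp add: rs_0 power_int_minus)
  next
    case (Suc n)
    have ins: "{N..N + int (Suc n) - 1} = insert (N + int n) {N..N + int n - 1}"
      by auto
    have "rs (Suc n) * prm powi (N + int (Suc n)) = (rs n - rep (rs n)) * prm powi (N + int n)"
      by (simp add: rs_Suc power_int_add_1 add.assoc[symmetric] add.commute[of 1])
    moreover have "c (N + int n) = rep (rs n)"
      by (simp add: c_def)
    ultimately show ?case
      unfolding ins using Suc by (simp add: algebra_simps)
  qed
  have bound: "absv (x - (\<Sum>k\<in>{N..M}. c k * prm powi k)) \<le> real q powi (- (M + 1))" for M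
  proof (cases "M \<ge> N")
    case True
    define n where "n = nat (M + 1 - N)"
    have n: "M = N + int n - 1"
      using True by (simp add: n_def)
    have "x - (\<Sum>k\<in>{N..M}. c k * prm powi k) = rs n * prm powi (M + 1)"
      using sum[of n] unfolding n by (simp add: algebra_simps)
    thus ?thesis
      using rs_le[of n] by (simp add: absv_mult absv_prm_powi mult_left_le_one_le)
  next
    \<comment> \<open>Here the sum is empty, and the claim is just the initial bound on
      \<open>x\<close>.\<close>
    case False
    have "absv x \<le> real q powi (- (M + 1))"
      using K by (rule order_trans) (use False in \<open>auto intro!: power_int_increasing simp: N_def\<close>)
    thus ?thesis
      using False by simp
  qed
  have "is_expansion absv q prm C x c"
    unfolding is_expansion_iff using bound rep rs_le zero_in_C
    by (intro conjI exI[of _ N]) (auto simp: c_def)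
  thus ?thesis by blast
qed

text \<open>The definite description in \<open>digit\<close> calls for uniqueness too: two
  expansions of one point have distance 0, so by \<open>expansion_agree_iff\<close> they agree below
  every place.\<close>

lemma digit_expansion: "is_expansion absv q prm C x (digit absv q prm C x)"
proof -
  obtain c where c: "is_expansion absv q prm C x c"
    using ex_expansion by blast
  have "d = c" if "is_expansion absv q prm C x d" for d
  proof
    fix i
    show "d i = c i"
      using expansion_agree_iff[OF that c, of "i + 1"] by simp
  qed
  thus ?thesis
    unfolding digit_def using c by (intro theI[of "is_expansion absv q prm C x"]) auto
qed

lemma digit0_in_C: "digit0 absv q prm C x \<in> C"
  unfolding digit0_def using digit_expansion is_expansion_in_C by blast

text \<open>The assumed bound makes all digits at negative places agree, so that agreement below
  place 1 reduces to agreement at place 0.\<close>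

lemma digit0_eq_iff:
  assumes "absv (x - y) \<le> 1"
  shows "digit0 absv q prm C x = digit0 absv q prm C y \<longleftrightarrow> absv (x - y) \<le> 1 / real q"
proof -
  note agree = expansion_agree_iff[OF digit_expansion[of x] digit_expansion[of y]]
  have "\<forall>i<0. digit absv q prm C x i = digit absv q prm C y i"
    using agree[of 0] assms by simp
  moreover have "(i < 1) = (i < 0 \<or> i = 0)" for i :: int
    by auto
  ultimately show ?thesis
    using agree[of 1] unfolding digit0_def by (auto simp: power_int_minus field_simps)
qed

text \<open>Removing its digit at place 0 from the integral part leaves only terms of positive
  places, of absolute value at most 1/q. Distinct elements of \<open>C\<close> are at distance 1, so
  the disk identifies the digit.\<close>

lemma intpart_in_disk_iff:
  assumes "c \<in> C"
  shows "intpart absv q prm C x \<in> disk absv c (1 / real q) \<longleftrightarrow> digit0 absv q prm C x = c"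
proof -
  let ?d = "digit absv q prm C x"
  obtain N where N: "\<forall>n<N. ?d n = 0" "\<forall>N'\<le>N. \<forall>M.
      absv (x - (\<Sum>k\<in>{N'..M}. ?d k * prm powi k)) \<le> real q powi (- (M + 1))"
    using is_expansion_start[OF digit_expansion] by blast
  \<comment> \<open>Lowering the start to at most 0 ensures that \<open>{N'..0}\<close> contains
    place 0 as well as every negative place with a nonzero digit.\<close>
  define N' where "N' = min N 0"
  have "(\<Sum>k\<in>{k. k < 0 \<and> ?d k \<noteq> 0}. ?d k * prm powi k) = (\<Sum>k\<in>{N'..-1}. ?d k * prm powi k)"
    using N(1) by (intro sum.mono_neutral_left) (auto simp: N'_def not_less[symmetric])
  moreover have ins: "{N'..0} = insert 0 {N'..-1}"
    by (auto simp: N'_def)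
  ultimately have "x - (\<Sum>k\<in>{N'..0}. ?d k * prm powi k) = intpart absv q prm C x - ?d 0"
    unfolding intpart_def ins by simp
  moreover have "absv (x - (\<Sum>k\<in>{N'..0}. ?d k * prm powi k)) \<le> 1 / real q"
    using N(2)[rule_format, of N' 0] by (simp add: N'_def power_int_minus field_simps)
  ultimately have near: "absv (intpart absv q prm C x - ?d 0) \<le> 1 / real q"
    by simp
  show ?thesis
  proof
    assume "intpart absv q prm C x \<in> disk absv c (1 / real q)"
    hence "absv (?d 0 - c) \<le> 1 / real q"
      using near absv_diff_le_trans[of "?d 0" _ "1 / real q" c] absv_minus_commute
      by (auto simp: disk_def)
    moreover have "1 / real q < 1"
      by simp
    ultimately show "digit0 absv q prm C x = c"
      using assms digit0_in_C[of x] C_eqI[of "?d 0" c] unfolding digit0_def by linarith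
  qed (use near in \<open>auto simp: disk_def digit0_def\<close>)
qed


section \<open>Digits of scaling maps as coordinates on a disk\<close>

lemma scaling_digit0_eq_iff:
  assumes "scaling_map absv q \<Omega> h j" "x \<in> \<Omega>" "y \<in> \<Omega>" "absv (x - y) \<le> real q powi (- j)"
  shows "digit0 absv q prm C (h x) = digit0 absv q prm C (h y) \<longleftrightarrow>
    absv (x - y) \<le> real q powi (- (j + 1))"
proof -
  have eq: "absv (h x - h y) = real q powi j * absv (x - y)"
    using assms(1-3) by (simp add: scaling_map_def powr_eq_powi)
  have pos: "real q powi j > 0"
    by simp
  \<comment> \<open>The map stretches distances by q^j, which brings the two images into the range
    of \<open>digit0_eq_iff\<close>.\<close>
  have "absv (h x - h y) \<le> 1"
    using assms(4) pos unfolding eq power_int_minus by (simp add: field_simps)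
  moreover have "real q powi j * absv (x - y) \<le> 1 / real q \<longleftrightarrow> absv (x - y) \<le> real q powi (- (j + 1))"
    using pos unfolding power_int_minus by (simp add: power_int_add field_simps)
  ultimately show ?thesis
    using digit0_eq_iff eq by simp
qed

lemma mem_disk_trans: "x \<in> disk absv a b \<Longrightarrow> absv (y - x) \<le> b \<Longrightarrow> y \<in> disk absv a b"
  unfolding disk_def using absv_diff_le_trans by blast

lemma mem_disk_dist: "x \<in> disk absv a b \<Longrightarrow> y \<in> disk absv a b \<Longrightarrow> absv (x - y) \<le> b"
  unfolding disk_def using absv_diff_le_trans absv_minus_commute by (metis mem_Collect_eq)

lemma powi_antimono: "i \<le> j \<Longrightarrow> real q powi (- j) \<le> real q powi (- i)"
  by (intro power_int_increasing) auto

text \<open>Distinct representatives d give distinct digits of h (x + d * prm powi j), and C is finite, so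
  every digit occurs.\<close>
lemma ex_digit0_eq:
  assumes sc: "scaling_map absv q (disk absv a (real q powi (- R))) h j" and "R \<le> j"
    and x: "x \<in> disk absv a (real q powi (- R))" and c: "c \<in> C"
  shows "\<exists>y. absv (y - x) \<le> real q powi (- j) \<and> digit0 absv q prm C (h y) = c"
proof -
  define y where "y d = x + d * prm powi j" for d
  define g where "g d = digit0 absv q prm C (h (y d))" for d
  have yx: "absv (y d - x) \<le> real q powi (- j)" if "d \<in> C" for d
    using C_le_1[OF that] by (simp add: y_def absv_mult absv_prm_powi mult_left_le_one_le)
  have y: "y d \<in> disk absv a (real q powi (- R))" if "d \<in> C" for d
    using yx[OF that] powi_antimono[OF \<open>R \<le> j\<close>] by (intro mem_disk_trans[OF x]) simp
  have "inj_on g C"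
  proof (rule inj_onI)
    fix d e assume de: "d \<in> C" "e \<in> C" "g d = g e"
    have diff: "y d - y e = (d - e) * prm powi j"
      by (simp add: y_def algebra_simps)
    have "absv (y d - y e) \<le> real q powi (- j)"
      using yx[of d] yx[of e] de absv_diff_le_trans absv_minus_commute by metis
    hence "absv (y d - y e) \<le> real q powi (- (j + 1))"
      using scaling_digit0_eq_iff[OF sc y[OF de(1)] y[OF de(2)]] de(3) by (simp add: g_def)
    also have "\<dots> < real q powi (- j)"
      by (intro power_int_strict_increasing) auto
    finally show "d = e"
      using de unfolding diff by (intro C_eqI'[of d e j]) auto
  qed
  moreover have "g ` C \<subseteq> C"
    by (auto simp: g_def digit0_in_C)
  ultimately have "g ` C = C"
    using finite_C by (intro endo_inj_surj)
  then obtain d where "d \<in> C" "g d = c"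
    using c by (metis imageE)
  thus ?thesis
    using yx by (intro exI[of _ "y d"]) (simp add: g_def)
qed

text \<open>The digits are set one after another by \<open>ex_digit0_eq\<close>. The correction at
  stage \<open>k\<close> has size at most q^(-(R + k)), too small to disturb the digits set before,
  so the corrected points form a Cauchy sequence whose limit has all the prescribed digits.\<close>

lemma ex_point_with_digits:
  assumes sc: "\<And>j. R \<le> j \<Longrightarrow> scaling_map absv q (disk absv a (real q powi (- R))) (h j) j"
    and w: "\<And>k. w k \<in> C"
  shows "\<exists>x\<in>disk absv a (real q powi (- R)). \<forall>k::nat. digit0 absv q prm C (h (R + int k) x) = w k"
proof -
  define D where "D = disk absv a (real q powi (- R))"
  define \<rho> where "\<rho> k = real q powi (- (R + int k))" for k :: nat
  have \<rho>_le: "\<rho> n \<le> \<rho> m" if "m \<le> n" for m n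
    unfolding \<rho>_def using that by (intro powi_antimono) auto
  define nxt where
    "nxt k x = (SOME y. absv (y - x) \<le> \<rho> k \<and> digit0 absv q prm C (h (R + int k) y) = w k)" for k x
  have nxt: "absv (nxt k x - x) \<le> \<rho> k \<and> digit0 absv q prm C (h (R + int k) (nxt k x)) = w k"
    if "x \<in> D" for k x
    unfolding nxt_def \<rho>_def
    by (rule someI_ex, rule ex_digit0_eq[OF sc]) (use that w in \<open>auto simp: D_def\<close>)
  define X where "X = rec_nat a nxt"
  have X_Suc: "X (Suc k) = nxt k (X k)" for k
    by (simp add: X_def)
  have XD: "X k \<in> D" for k
  proof (induction k)
    case 0
    thus ?case by (simp add: X_def D_def disk_def)
  next
    case (Suc k)
    have "absv (X (Suc k) - X k) \<le> real q powi (- R)"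
      using nxt[OF Suc, of k] \<rho>_le[of 0 k] by (simp add: X_Suc \<rho>_def)
    thus ?case
      using Suc mem_disk_trans unfolding D_def by blast
  qed
  have close: "absv (X (m + n) - X m) \<le> \<rho> m" for m n
  proof (induction n)
    case 0
    thus ?case by (simp add: \<rho>_def)
  next
    case (Suc n)
    have "absv (X (Suc (m + n)) - X (m + n)) \<le> \<rho> m"
      using nxt[OF XD, of "m + n" "m + n"] \<rho>_le[of m "m + n"] by (simp add: X_Suc)
    thus ?case
      using Suc absv_diff_le_trans by simp
  qed
  have small: "\<exists>N. \<rho> N < e" if "e > 0" for e
  proof -
    obtain k :: int where k: "real q powi k \<le> e / 2"
      using ex_powi_le[of "e / 2"] \<open>e > 0\<close> by auto
    have "\<rho> (nat (- k - R)) \<le> real q powi k"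
      unfolding \<rho>_def by (intro power_int_increasing) auto
    thus ?thesis
      using k \<open>e > 0\<close> by (intro exI[of _ "nat (- k - R)"]) simp
  qed
  have "\<exists>N. \<forall>m\<ge>N. \<forall>n\<ge>N. absv (X m - X n) < e" if e: "e > 0" for e
  proof -
    obtain N where N: "\<rho> N < e"
      using small[OF e] by blast
    have "absv (X m - X N) \<le> \<rho> N" if "m \<ge> N" for m
      using close[of N "m - N"] that by simp
    hence "absv (X m - X n) \<le> \<rho> N" if "m \<ge> N" "n \<ge> N" for m n
      using that absv_diff_le_trans absv_minus_commute by metis
    thus ?thesis
      using N by (meson le_less_trans)
  qed
  then obtain x where x: "(\<lambda>n. absv (X n - x)) \<longlonglongrightarrow> 0"
    using absv_complete by blast
  \<comment> \<open>Some later \<open>X (m + n)\<close> is within \<open>\<rho> m\<close> of the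
    limit, and the ultrametric inequality loses nothing when passing back to
    \<open>X m\<close>.\<close>
  have lim: "absv (x - X m) \<le> \<rho> m" for m
  proof -
    have "\<rho> m > 0"
      by (simp add: \<rho>_def)
    hence "\<forall>\<^sub>F n in sequentially. absv (X n - x) < \<rho> m"
      by (rule order_tendstoD(2)[OF x])
    then obtain n where "\<forall>k\<ge>n. absv (X k - x) < \<rho> m"
      unfolding eventually_sequentially by blast
    hence "absv (X (m + n) - x) < \<rho> m"
      by simp
    thus ?thesis
      using close[of m n] absv_diff_le_trans[of x "X (m + n)" "\<rho> m" "X m"] absv_minus_commute
      by simp
  qed
  have xD: "x \<in> D"
    using mem_disk_trans[of "X 0" a "real q powi (- R)" x] XD[of 0] lim[of 0]
    by (simp add: D_def \<rho>_def)
  have "digit0 absv q prm C (h (R + int k) x) = w k" for k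
  proof -
    \<comment> \<open>\<open>X (Suc k)\<close> is the point at which digit \<open>k\<close> was set;
      the limit is close enough to it to share this digit.\<close>
    have le: "absv (x - X (Suc k)) \<le> real q powi (- (R + int k + 1))"
      using lim[of "Suc k"] by (simp add: \<rho>_def add_ac)
    also have "\<dots> \<le> real q powi (- (R + int k))"
      by (intro powi_antimono) auto
    finally have "digit0 absv q prm C (h (R + int k) x) = digit0 absv q prm C (h (R + int k) (X (Suc k)))"
      using scaling_digit0_eq_iff[OF sc] xD XD[of "Suc k"] le unfolding D_def by simp
    thus ?thesis
      using nxt[OF XD] by (simp add: X_Suc)
  qed
  thus ?thesis
    using xD unfolding D_def by blast
qed

lemma digits_agree:
  assumes sc: "\<And>j. R \<le> j \<Longrightarrow> scaling_map absv q (disk absv a (real q powi (- R))) (h j) j"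
    and "x \<in> disk absv a (real q powi (- R))" "y \<in> disk absv a (real q powi (- R))"
    and le: "absv (x - y) \<le> real q powi (- (R + int k))" and "i < k"
  shows "digit0 absv q prm C (h (R + int i) x) = digit0 absv q prm C (h (R + int i) y)"
proof -
  have "absv (x - y) \<le> real q powi (- (R + int i + 1))"
    using le powi_antimono[of "R + int i + 1" "R + int k"] \<open>i < k\<close> by linarith
  moreover have "real q powi (- (R + int i + 1)) \<le> real q powi (- (R + int i))"
    by (intro powi_antimono) auto
  ultimately show ?thesis
    using scaling_digit0_eq_iff[OF sc, of "R + int i" x y] assms(2,3) by simp
qed

section \<open>Bounds for the Hausdorff measure\<close>

lemma disk_cover:
  "\<exists>S. finite S \<and> card S \<le> q ^ k \<and>
    disk absv a (real q powi (- R)) \<subseteq> (\<Union>x\<in>S. disk absv x (real q powi (- (R + int k))))"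
proof (induction k)
  case 0
  show ?case by (intro exI[of _ "{a}"]) auto
next
  case (Suc k)
  then obtain S where S: "finite S" "card S \<le> q ^ k"
    "disk absv a (real q powi (- R)) \<subseteq> (\<Union>x\<in>S. disk absv x (real q powi (- (R + int k))))"
    by blast
  define j where "j = R + int k"
  \<comment> \<open>Every disk of radius q^(-j) splits into \<open>q\<close> disks of radius q^(-(j
    + 1)), one for each representative of the rescaled offset from its centre.\<close>
  define S' where "S' = (\<lambda>(x, c). x + c * prm powi j) ` (S \<times> C)"
  have "disk absv x (real q powi (- j)) \<subseteq> (\<Union>y\<in>S'. disk absv y (real q powi (- (j + 1))))"
    if "x \<in> S" for x
  proof
    fix z assume "z \<in> disk absv x (real q powi (- j))"
    hence "absv (z - x) * real q powi j \<le> real q powi (- j) * real q powi j"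
      by (intro mult_right_mono) (auto simp: disk_def)
    also have "\<dots> = 1"
      by (simp add: power_int_minus)
    finally have "absv ((z - x) * prm powi (- j)) \<le> 1"
      by (simp only: absv_mult absv_prm_powi minus_minus)
    from ex1_rep[OF this] obtain c
      where c: "c \<in> C" "absv ((z - x) * prm powi (- j) - c) < real q powi 0"
      unfolding power_int_0_right by blast
    have "z - (x + c * prm powi j) = ((z - x) * prm powi (- j) - c) * prm powi j"
      by (simp add: power_int_minus field_simps)
    hence "absv (z - (x + c * prm powi j)) = absv ((z - x) * prm powi (- j) - c) * real q powi (- j)"
      by (simp add: absv_mult absv_prm_powi)
    also have "\<dots> \<le> real q powi (0 - 1) * real q powi (- j)"
      using absv_discrete[OF c(2)] by (intro mult_right_mono) auto
    also have "\<dots> = real q powi (- (j + 1))"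
      by (subst power_int_add[symmetric]) (auto intro!: arg_cong[where f = "power_int _"])
    finally show "z \<in> (\<Union>y\<in>S'. disk absv y (real q powi (- (j + 1))))"
      using that c(1) by (auto simp: S'_def disk_def)
  qed
  hence "disk absv a (real q powi (- R)) \<subseteq> (\<Union>y\<in>S'. disk absv y (real q powi (- (j + 1))))"
    using S(3) unfolding j_def by blast
  moreover have "card S' \<le> q ^ Suc k"
  proof -
    have "card S' \<le> card (S \<times> C)"
      unfolding S'_def using S(1) finite_C by (intro card_image_le) auto
    also have "\<dots> \<le> q ^ k * q"
      using S(2) card_C by (simp add: card_cartesian_product)
    finally show ?thesis by (simp add: mult.commute)
  qed
  moreover have "finite S'"
    unfolding S'_def using S(1) finite_C by auto
  ultimately show ?case
    by (intro exI[of _ S']) (auto simp: j_def add_ac)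
qed

lemma bdd_above_disk_dist:
  "bdd_above {absv (x - y) | x y. x \<in> disk absv a b \<and> y \<in> disk absv a b}"
  using mem_disk_dist by (intro bdd_aboveI[of _ b]) auto

lemma adiam_disk_le: "b \<ge> 0 \<Longrightarrow> adiam absv (disk absv a b) \<le> b"
proof (cases "disk absv a b = {}")
  case False
  then obtain z where "z \<in> disk absv a b"
    by blast
  hence "absv (z - z) \<in> {absv (x - y) | x y. x \<in> disk absv a b \<and> y \<in> disk absv a b}"
    by blast
  hence "Sup {absv (x - y) | x y. x \<in> disk absv a b \<and> y \<in> disk absv a b} \<le> b"
    by (intro cSup_least) (use mem_disk_dist in blast)+
  thus ?thesis
    using False by (simp add: adiam_def)
qed (simp add: adiam_def)

lemma dist_le_adiam:
  assumes "bdd_above {absv (x - y) | x y. x \<in> U \<and> y \<in> U}" "x \<in> U" "y \<in> U"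
  shows "absv (x - y) \<le> adiam absv U"
proof -
  have "absv (x - y) \<le> Sup {absv (x - y) | x y. x \<in> U \<and> y \<in> U}"
    using assms by (intro cSup_upper) blast+
  thus ?thesis
    using assms(2) unfolding adiam_def by auto
qed

lemma hausdorff_pre_le_cover:
  assumes "finite S" "E \<subseteq> (\<Union>x\<in>S. disk absv x \<rho>)" "\<rho> > 0" "\<rho> \<le> \<delta>" "s > 0"
  shows "hausdorff_pre absv s \<delta> E \<le> ennreal (real (card S) * \<rho> powr s)"
proof -
  obtain g where g: "bij_betw g {0..<card S} S"
    using ex_bij_betw_nat_finite[OF assms(1)] by blast
  \<comment> \<open>Covers are sequences by definition, so the finite cover is continued by empty
    sets, which contribute 0.\<close>
  define U where "U i = (if i < card S then disk absv (g i) \<rho> else {})" for i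
  have diam: "adiam absv (U i) \<le> \<rho>" "adiam absv (U i) \<ge> 0" for i
  proof -
    show "adiam absv (U i) \<le> \<rho>"
      using adiam_disk_le[of \<rho> "g i"] \<open>\<rho> > 0\<close> by (auto simp: U_def adiam_def[of _ "{}"])
    have "g i \<in> disk absv (g i) \<rho>"
      using \<open>\<rho> > 0\<close> by (simp add: disk_def)
    from dist_le_adiam[OF bdd_above_disk_dist this this] show "adiam absv (U i) \<ge> 0"
      by (auto simp: U_def adiam_def[of _ "{}"])
  qed
  have "E \<subseteq> (\<Union>i. U i)"
  proof
    fix z assume "z \<in> E"
    then obtain x where x: "x \<in> S" "z \<in> disk absv x \<rho>"
      using assms(2) by blast
    obtain i where "i < card S" "x = g i"
      using x(1) bij_betw_imp_surj_on[OF g] by (metis imageE atLeastLessThan_iff)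
    thus "z \<in> (\<Union>i. U i)"
      using x(2) by (auto simp: U_def intro!: exI[of _ i])
  qed
  moreover have "bdd_above {absv (x - y) | x y. x \<in> U i \<and> y \<in> U i}" for i
  proof (cases "i < card S")
    case True
    thus ?thesis using bdd_above_disk_dist by (simp add: U_def)
  qed (simp add: U_def)
  moreover have "adiam absv (U i) \<le> \<delta>" for i
    using diam(1)[of i] \<open>\<rho> \<le> \<delta>\<close> by linarith
  ultimately have "hausdorff_pre absv s \<delta> E \<le> (\<Sum>i. ennreal (adiam absv (U i) powr s))"
    unfolding hausdorff_pre_def by (intro INF_lower CollectI conjI allI)
  also have "\<dots> = (\<Sum>i<card S. ennreal (adiam absv (U i) powr s))"
    by (intro suminf_finite) (auto simp: U_def adiam_def)
  also have "\<dots> \<le> (\<Sum>i<card S. ennreal (\<rho> powr s))"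
    using diam \<open>s > 0\<close> by (intro sum_mono ennreal_leI powr_mono2) auto
  also have "\<dots> = ennreal (real (card S) * \<rho> powr s)"
    by (simp add: ennreal_mult ennreal_of_nat_eq_real_of_nat)
  finally show ?thesis .
qed

text \<open>Covering the disk by at most q^k disks of radius q^(-(R + k)) costs at most
  \<open>g k\<close>, a geometric sequence of ratio q^(1 - s) < 1.\<close>

lemma hausdorff_measure_eq_0:
  assumes "E \<subseteq> disk absv a b" "s > 1"
  shows "hausdorff_measure absv s E = 0"
proof -
  obtain R' :: int where "b \<le> real q powi R'"
    using ex_powi_ge by blast
  define R where "R = - R'"
  have E: "E \<subseteq> disk absv a (real q powi (- R))"
    using assms(1) \<open>b \<le> _\<close> by (force simp: disk_def R_def)
  define g where "g k = real q powr (- real_of_int R * s) * (real q powr (1 - s)) ^ k" for k :: nat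
  have "real q powr 0 = 1"
    by (metis powr_zero_eq_one less_irrefl q_pos(6))
  moreover have "real q powr (1 - s) < real q powr 0"
    using \<open>s > 1\<close> by (intro powr_less_mono) simp_all
  ultimately have "real q powr (1 - s) < 1"
    by linarith
  hence "(\<lambda>k. (real q powr (1 - s)) ^ k) \<longlonglongrightarrow> 0"
    by (intro LIMSEQ_power_zero) auto
  hence "g \<longlonglongrightarrow> 0"
    unfolding g_def by (intro tendsto_mult_right_zero)
  hence glim: "(\<lambda>k. ennreal (g k)) \<longlonglongrightarrow> 0"
    using tendsto_ennrealI by force
  have "hausdorff_pre absv s \<delta> E \<le> 0" if "\<delta> > 0" for \<delta>
  proof -
    obtain m :: int where m: "real q powi m \<le> \<delta>"
      using ex_powi_le[OF \<open>\<delta> > 0\<close>] by blast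
    have "hausdorff_pre absv s \<delta> E \<le> ennreal (g k)" if k: "k \<ge> nat (- m - R)" for k
    proof -
      define \<rho> where "\<rho> = real q powi (- (R + int k))"
      have "\<rho> \<le> real q powi m"
        unfolding \<rho>_def using k by (intro power_int_increasing) auto
      hence "\<rho> \<le> \<delta>"
        using m by linarith
      have "\<rho> > 0"
        by (simp add: \<rho>_def)
      obtain S where S: "finite S" "card S \<le> q ^ k"
        "disk absv a (real q powi (- R)) \<subseteq> (\<Union>x\<in>S. disk absv x \<rho>)"
        using disk_cover[of k a R] unfolding \<rho>_def by blast
      have "hausdorff_pre absv s \<delta> E \<le> ennreal (real (card S) * \<rho> powr s)"
        using S E \<open>\<rho> > 0\<close> \<open>\<rho> \<le> \<delta>\<close> \<open>s > 1\<close> by (intro hausdorff_pre_le_cover) auto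
      also have "\<dots> \<le> ennreal (real (q ^ k) * \<rho> powr s)"
        using S(2) by (intro ennreal_leI mult_right_mono) (auto simp del: of_nat_power)
      also have "real (q ^ k) * \<rho> powr s = g k"
      proof -
        have "\<rho> powr s = real q powr (- (real_of_int R + real k) * s)"
          unfolding \<rho>_def powr_eq_powi[symmetric] by (simp add: powr_powr)
        moreover have "real (q ^ k) = real q powr real k"
          by (simp add: powr_realpow)
        moreover have "g k = real q powr (- real_of_int R * s) * real q powr ((1 - s) * real k)"
          by (simp add: g_def powr_powr flip: powr_realpow)
        ultimately show ?thesis
          by (simp add: algebra_simps flip: powr_add)
      qed
      finally show ?thesis .
    qed
    thus ?thesis
      by (intro LIMSEQ_le_const[OF glim]) blast
  qed
  thus ?thesis
    unfolding hausdorff_measure_def by (intro antisym SUP_least) auto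
qed

text \<open>A mass distribution argument with Lebesgue measure on [0,1). For each \<open>b\<close>,
  the parameters that \<open>\<Phi> b\<close> sends into \<open>U i\<close> lie in an interval of
  length 2 K d, where d is the diameter of \<open>U i\<close> to the power \<open>s\<close>. The
  intervals for both values of \<open>b\<close> and all \<open>i\<close> cover [0,1), so these
  powers sum to at least 1/(4K).\<close>

lemma hausdorff_measure_pos:
  fixes \<Phi> :: "bool \<Rightarrow> real \<Rightarrow> 'a"
  assumes "s > 0" "K > 0"
    and hoelder: "\<And>b t u. t \<in> {0..<1} \<Longrightarrow> u \<in> {0..<1} \<Longrightarrow> \<bar>t - u\<bar> \<le> K * absv (\<Phi> b t - \<Phi> b u) powr s"
    and hit: "\<And>t. t \<in> {0..<1} \<Longrightarrow> \<exists>b. \<Phi> b t \<in> E"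
  shows "hausdorff_measure absv s E \<noteq> 0"
proof -
  have lower: "ennreal (1 / (4 * K)) \<le> (\<Sum>i. ennreal (adiam absv (U i) powr s))"
    if U: "E \<subseteq> (\<Union>i. U i)" "\<And>i. bdd_above {absv (x - y) | x y. x \<in> U i \<and> y \<in> U i}"
    for U :: "nat \<Rightarrow> 'a set"
  proof -
    define d where "d i = adiam absv (U i) powr s" for i
    \<comment> \<open>The preimage itself may fail to be measurable and is therefore enclosed in an
      interval around one of its points.\<close>
    have "\<exists>T \<in> sets lborel. {t \<in> {0..<1}. \<Phi> b t \<in> U i} \<subseteq> T \<and> emeasure lborel T \<le> ennreal (2 * K * d i)"
      for b i
    proof (cases "{t \<in> {0..<1}. \<Phi> b t \<in> U i} = {}")
      case True
      thus ?thesis by (intro bexI[of _ "{}"]) auto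
    next
      case False
      then obtain u where u: "u \<in> {0..<1}" "\<Phi> b u \<in> U i"
        by blast
      have "\<bar>t - u\<bar> \<le> K * d i" if t: "t \<in> {0..<1}" "\<Phi> b t \<in> U i" for t
      proof -
        have "absv (\<Phi> b t - \<Phi> b u) powr s \<le> d i"
          unfolding d_def using dist_le_adiam[OF U(2) t(2) u(2)] \<open>s > 0\<close> by (intro powr_mono2) auto
        hence "K * absv (\<Phi> b t - \<Phi> b u) powr s \<le> K * d i"
          using \<open>K > 0\<close> by (intro mult_left_mono) auto
        thus ?thesis
          using hoelder[OF t(1) u(1), of b] by linarith
      qed
      hence "{t \<in> {0..<1}. \<Phi> b t \<in> U i} \<subseteq> {u - K * d i .. u + K * d i}"
        by (force simp: abs_le_iff)
      moreover have "0 \<le> K * d i"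
        using \<open>K > 0\<close> by (simp add: d_def)
      ultimately show ?thesis
        by (intro bexI[of _ "{u - K * d i .. u + K * d i}"]) (auto intro!: ennreal_leI)
    qed
    then obtain T where T: "\<And>b i. T b i \<in> sets lborel"
      "\<And>b i. {t \<in> {0..<1}. \<Phi> b t \<in> U i} \<subseteq> T b i"
      "\<And>b i. emeasure lborel (T b i) \<le> ennreal (2 * K * d i)"
      by metis
    have "{0..<1} \<subseteq> (\<Union>i. T True i \<union> T False i)"
    proof
      fix t :: real assume t: "t \<in> {0..<1}"
      then obtain b where "\<Phi> b t \<in> E"
        using hit by blast
      then obtain i where "\<Phi> b t \<in> U i"
        using U(1) by blast
      hence "t \<in> T b i"
        using T(2) t by blast
      thus "t \<in> (\<Union>i. T True i \<union> T False i)"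
        by (cases b) auto
    qed
    hence "emeasure lborel {0..<1::real} \<le> emeasure lborel (\<Union>i. T True i \<union> T False i)"
      using T(1) by (intro emeasure_mono) auto
    also have "\<dots> \<le> (\<Sum>i. emeasure lborel (T True i \<union> T False i))"
      using T(1) by (intro emeasure_subadditive_countably) auto
    also have "\<dots> \<le> (\<Sum>i. ennreal (4 * K) * ennreal (d i))"
    proof (intro suminf_le allI)
      fix i
      have "emeasure lborel (T True i \<union> T False i) \<le> emeasure lborel (T True i) + emeasure lborel (T False i)"
        using T(1) by (intro emeasure_subadditive)
      also have "\<dots> \<le> ennreal (2 * K * d i) + ennreal (2 * K * d i)"
        using T(3) by (intro add_mono)
      also have "\<dots> = ennreal (4 * K) * ennreal (d i)"
        using \<open>K > 0\<close> by (simp add: d_def flip: ennreal_plus ennreal_mult)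
      finally show "emeasure lborel (T True i \<union> T False i) \<le> ennreal (4 * K) * ennreal (d i)" .
    qed auto
    also have "\<dots> = ennreal (4 * K) * (\<Sum>i. ennreal (d i))"
      by (rule ennreal_suminf_cmult)
    finally have "1 \<le> ennreal (4 * K) * (\<Sum>i. ennreal (d i))"
      by simp
    hence "ennreal (1 / (4 * K)) * 1 \<le> ennreal (1 / (4 * K)) * (ennreal (4 * K) * (\<Sum>i. ennreal (d i)))"
      by (rule mult_left_mono) simp
    also have "\<dots> = (\<Sum>i. ennreal (d i))"
      using \<open>K > 0\<close> by (simp flip: mult.assoc ennreal_mult)
    finally show ?thesis
      by (simp add: d_def)
  qed
  \<comment> \<open>The lower bound holds for covers of any mesh, so the single scale 1 is
    enough.\<close>
  have "ennreal (1 / (4 * K)) \<le> hausdorff_pre absv s 1 E"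
    unfolding hausdorff_pre_def by (intro INF_greatest lower) auto
  also have "\<dots> \<le> hausdorff_measure absv s E"
    unfolding hausdorff_measure_def by (intro SUP_upper) auto
  finally show ?thesis
    using \<open>K > 0\<close> by auto
qed

end

section \<open>Monotonicity and dimension one\<close>

lemma hausdorff_measure_mono:
  assumes "E \<subseteq> F"
  shows "hausdorff_measure absv s E \<le> hausdorff_measure absv s F"
  unfolding hausdorff_measure_def hausdorff_pre_def
  by (intro SUP_mono' INF_superset_mono) (use assms in auto)

text \<open>The infimum is settled by the exponents on either side of 1; the measure at exponent 1
  itself stays open.\<close>

lemma hausdorff_dim_eq_1:
  assumes pos: "\<And>s. 0 < s \<Longrightarrow> s < 1 \<Longrightarrow> hausdorff_measure absv s E \<noteq> 0"
    and zero: "\<And>s. s > 1 \<Longrightarrow> hausdorff_measure absv s E = 0"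
  shows "hausdorff_dim absv E = 1"
proof (rule antisym)
  show "hausdorff_dim absv E \<le> 1"
  proof (rule ereal_le_epsilon2)
    fix e :: real assume "e > 0"
    hence "hausdorff_dim absv E \<le> ereal (1 + e)"
      unfolding hausdorff_dim_def by (intro INF_lower) (auto intro!: zero)
    thus "hausdorff_dim absv E \<le> 1 + ereal e"
      by (simp add: one_ereal_def)
  qed
  show "1 \<le> hausdorff_dim absv E"
    unfolding hausdorff_dim_def
  proof (intro INF_greatest)
    fix s assume "s \<in> {s. 0 < s \<and> hausdorff_measure absv s E = 0}"
    hence "1 \<le> s"
      using pos[of s] by (cases "s < 1") auto
    thus "1 \<le> ereal s"
      by (simp add: one_ereal_def)
  qed
qed

section \<open>Frequencies of a symbol and base q digits of reals\<close>

lemma not_both_ud_symbols: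
  assumes ud: "ud_symbols C s" "ud_symbols C s'" and c: "c \<in> C" and "L > 0" "n0 \<ge> 1"
    and imp: "\<And>n. n \<ge> n0 \<Longrightarrow> s' n = c \<Longrightarrow> s n = c"
    and forced: "\<And>u. s (n0 + L * u) = c" "\<And>u. s' (n0 + L * u) \<noteq> c"
  shows False
proof -
  define cnt where "cnt s N = card {n \<in> {1..N}. s n = c}" for s :: "nat \<Rightarrow> 'a" and N :: nat
  define g where "g M = n0 + L * M" for M
  have "(\<lambda>N. real (cnt s N) / real N - real (cnt s' N) / real N) \<longlonglongrightarrow> 1 / real (card C) - 1 / real (card C)"
    using ud c unfolding ud_symbols_def cnt_def by (intro tendsto_diff) auto
  moreover have "strict_mono g"
    using \<open>L > 0\<close> by (simp add: g_def strict_mono_def)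
  ultimately have lim: "(\<lambda>M. real (cnt s (g M)) / real (g M) - real (cnt s' (g M)) / real (g M)) \<longlonglongrightarrow> 0"
    using LIMSEQ_subseq_LIMSEQ[of "\<lambda>N. real (cnt s N) / real N - real (cnt s' N) / real N" 0 g]
    by (simp add: o_def)
  \<comment> \<open>From \<open>n0\<close> on, an occurrence of \<open>c\<close> in
    \<open>s'\<close> is also one in \<open>s\<close>, and the M + 1 places \<open>g 0\<close>, ...,
    \<open>g M\<close> count for \<open>s\<close> alone. Indices below \<open>n0\<close> cost at
    most \<open>n0\<close>.\<close>
  have count: "cnt s' (g M) + (M + 1) \<le> cnt s (g M) + n0" for M
  proof -
    let ?A = "{n \<in> {1..g M}. s' n = c}" and ?B = "g ` {..M}"
    have "inj g"
      using \<open>strict_mono g\<close> by (rule strict_mono_imp_inj_on)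
    hence cB: "card ?B = M + 1"
      by (simp add: card_image inj_on_subset)
    have "cnt s' (g M) + (M + 1) = card (?A \<union> ?B)"
      unfolding cB[symmetric] cnt_def
      by (subst card_Un_disjoint) (use forced(2) in \<open>auto simp: g_def\<close>)
    also have "?A \<union> ?B \<subseteq> {n \<in> {1..g M}. s n = c} \<union> {..<n0}"
      using imp forced(1) \<open>n0 \<ge> 1\<close> by (auto simp: g_def)
    hence "card (?A \<union> ?B) \<le> card ({n \<in> {1..g M}. s n = c} \<union> {..<n0})"
      by (intro card_mono) auto
    also have "\<dots> \<le> cnt s (g M) + n0"
      unfolding cnt_def using card_Un_le[of _ "{..<n0}"] by simp
    finally show ?thesis .
  qed
  \<comment> \<open>For M >= 2 n0 the surplus is at least M/2 while \<open>g M\<close> is at most (L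
    + 1) M, so the two frequencies, which should have the same limit, stay at least \<open>e\<close>
    apart.\<close>
  define e where "e = 1 / (2 * (real L + 1))"
  have "e \<le> real (cnt s (g M)) / real (g M) - real (cnt s' (g M)) / real (g M)" if "M \<ge> 2 * n0" for M
  proof -
    have "real M > 0"
      using that \<open>n0 \<ge> 1\<close> by simp
    have pos: "real (g M) > 0"
      using \<open>n0 \<ge> 1\<close> unfolding of_nat_0_less_iff g_def by simp
    have "real (g M) \<le> (real L + 1) * real M"
      using that by (simp add: g_def algebra_simps)
    hence "e * real (g M) \<le> e * ((real L + 1) * real M)"
      by (intro mult_left_mono) (simp_all add: e_def)
    also have "\<dots> = real M / 2"
      by (simp add: e_def field_simps)
    also have "\<dots> \<le> real M + 1 - real n0"
      using that by linarith
    also have "\<dots> \<le> real (cnt s (g M)) - real (cnt s' (g M))"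
      using count[of M] by linarith
    finally show ?thesis
      using pos by (simp add: field_simps)
  qed
  hence "e \<le> 0"
    using LIMSEQ_le_const[OF lim] by blast
  thus False
    by (simp add: e_def)
qed

text \<open>For \<open>t\<close> in [0,1), index 0 is the first digit after the point.\<close>

definition base_digit :: "nat \<Rightarrow> real \<Rightarrow> nat \<Rightarrow> nat" where
  "base_digit q t m = nat (\<lfloor>t * real q ^ Suc m\<rfloor> mod int q)"

text \<open>With the digits of a real laid out in order on the places outside \<open>P\<close>, a
  free place \<open>k\<close> receives the digit of index \<open>free_rank P k\<close>.\<close>

definition free_rank :: "nat set \<Rightarrow> nat \<Rightarrow> nat" where
  "free_rank P k = card {i. i < k \<and> i \<notin> P}"

lemma free_rank_Suc: "free_rank P (Suc k) = (if k \<in> P then free_rank P k else Suc (free_rank P k))"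
proof -
  have "{i. i < Suc k \<and> i \<notin> P} = (if k \<in> P then {i. i < k \<and> i \<notin> P} else insert k {i. i < k \<and> i \<notin> P})"
    by (auto simp: less_Suc_eq)
  thus ?thesis
    by (simp add: free_rank_def)
qed

text \<open>Since \<open>p u\<close> is at least L u, at most k/L + 1 of the places below
  \<open>k\<close> are prescribed.\<close>

lemma free_rank_ge:
  assumes "L > 0" "\<And>u. p u \<ge> L * u"
  shows "real (free_rank (range p) k) \<ge> (1 - 1 / real L) * real k - 1"
proof -
  have "{i. i < k \<and> i \<in> range p} \<subseteq> p ` {..k div L}"
  proof
    fix i assume "i \<in> {i. i < k \<and> i \<in> range p}"
    then obtain u where u: "i = p u" "p u < k"
      by auto
    have "u * L \<le> k"
      using assms(2)[of u] u(2) by (simp add: mult.commute)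
    hence "u \<le> k div L"
      using \<open>L > 0\<close> by (simp add: less_eq_div_iff_mult_less_eq)
    thus "i \<in> p ` {..k div L}"
      using u(1) by blast
  qed
  hence "card {i. i < k \<and> i \<in> range p} \<le> card (p ` {..k div L})"
    by (intro card_mono) auto
  also have "\<dots> \<le> k div L + 1"
    using card_image_le[of "{..k div L}" p] by simp
  finally have forced: "card {i. i < k \<and> i \<in> range p} \<le> k div L + 1" .
  have "{..<k} = {i. i < k \<and> i \<notin> range p} \<union> {i. i < k \<and> i \<in> range p}"
    by blast
  hence "k = card ({i. i < k \<and> i \<notin> range p} \<union> {i. i < k \<and> i \<in> range p})"
    by (metis card_lessThan)
  also have "\<dots> = free_rank (range p) k + card {i. i < k \<and> i \<in> range p}"
    unfolding free_rank_def by (intro card_Un_disjoint) auto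
  finally have "real k \<le> real (free_rank (range p) k) + real (k div L) + 1"
    using forced by linarith
  moreover have "real (k div L) \<le> real k / real L"
    by (rule of_nat_div_le_of_nat)
  ultimately show ?thesis
    by (simp add: algebra_simps)
qed

text \<open>The floor at scale q^(m + 1) is \<open>q\<close> times the floor at scale q^m plus the
  digit of index m, so equal digits on the free places below \<open>k\<close> propagate equality of
  floors from scale 1, where both are 0.\<close>

lemma floor_eq_if_base_digits_eq:
  assumes "q > 0" "t \<in> {0..<1}" "u \<in> {0..<1}"
    and "\<And>i. i < k \<Longrightarrow> i \<notin> P \<Longrightarrow> base_digit q t (free_rank P i) = base_digit q u (free_rank P i)"
  shows "\<lfloor>t * real q ^ free_rank P k\<rfloor> = \<lfloor>u * real q ^ free_rank P k\<rfloor>"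
  using assms(4)
proof (induction k)
  case 0
  have "\<lfloor>t\<rfloor> = 0" "\<lfloor>u\<rfloor> = 0"
    using assms(2,3) by (simp_all add: floor_eq_iff)
  thus ?case
    by (simp add: free_rank_def)
next
  case (Suc k)
  define m where "m = free_rank P k"
  have IH: "\<lfloor>t * real q ^ m\<rfloor> = \<lfloor>u * real q ^ m\<rfloor>"
    using Suc unfolding m_def by simp
  show ?case
  proof (cases "k \<in> P")
    case True
    thus ?thesis
      using IH by (simp add: free_rank_Suc m_def)
  next
    case False
    have "\<lfloor>v * real q ^ Suc m\<rfloor> div int q = \<lfloor>v * real q ^ m\<rfloor>" for v
    proof -
      have "\<lfloor>v * real q ^ Suc m\<rfloor> div int q = \<lfloor>v * real q ^ Suc m / real_of_int (int q)\<rfloor>"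
        by (subst floor_divide_real_eq_div) auto
      also have "v * real q ^ Suc m / real_of_int (int q) = v * real q ^ m"
        using \<open>q > 0\<close> by simp
      finally show ?thesis .
    qed
    moreover have "\<lfloor>t * real q ^ Suc m\<rfloor> mod int q = \<lfloor>u * real q ^ Suc m\<rfloor> mod int q"
    proof -
      have "base_digit q t m = base_digit q u m"
        using Suc.prems[of k] False by (simp add: m_def)
      moreover have "\<lfloor>v * real q ^ Suc m\<rfloor> mod int q \<ge> 0" for v
        using \<open>q > 0\<close> by simp
      ultimately show ?thesis
        unfolding base_digit_def by (metis int_nat_eq)
    qed
    ultimately have "\<lfloor>t * real q ^ Suc m\<rfloor> = \<lfloor>u * real q ^ Suc m\<rfloor>"
      using IH by (metis mult_div_mod_eq)
    thus ?thesis
      using False by (simp add: free_rank_Suc m_def)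
  qed
qed

section \<open>Positive Hausdorff measure of the exceptional set\<close>

context local_field_digits
begin

lemma hausdorff_measure_not_ud_pos:
  assumes sc: "\<And>n. n \<ge> 1 \<Longrightarrow> scaling_map absv q (disk absv a r) (f n) (lam n)"
    and mono: "\<And>m n. 1 \<le> m \<Longrightarrow> m < n \<Longrightarrow> lam m < lam n" and "r > 0" "0 < s" "s < 1"
  shows "hausdorff_measure absv s
    {x \<in> disk absv a r. \<not> ud_symbols C (\<lambda>n. digit0 absv q prm C (f n x))} \<noteq> 0"
proof -
  \<comment> \<open>A concentric smaller disk whose radius is a power of \<open>q\<close> suffices
    for a lower bound.\<close>
  obtain R' :: int where "real q powi R' \<le> r"
    using ex_powi_le[OF \<open>r > 0\<close>] by blast
  define R where "R = - R'"
  define D where "D = disk absv a (real q powi (- R))"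
  have D_sub: "D \<subseteq> disk absv a r"
    using \<open>real q powi R' \<le> r\<close> by (auto simp: D_def R_def disk_def)
  have lam_ge: "lam (n + m) \<ge> lam n + int m" if "n \<ge> 1" for n m
  proof (induction m)
    case (Suc m)
    thus ?case
      using mono[of "n + m" "n + Suc m"] \<open>n \<ge> 1\<close> by simp
  qed simp
  \<comment> \<open>Integers that increase strictly gain at least 1 per step, so
    \<open>lam n\<close> has reached \<open>R\<close> by the index \<open>n0\<close>. From there on,
    \<open>pos n\<close> numbers the coordinate given by \<open>f n\<close>.\<close>
  define n0 where "n0 = 1 + nat (R - lam 1)"
  have n0: "n0 \<ge> 1" "lam n0 \<ge> R"
    using lam_ge[of 1 "nat (R - lam 1)"] by (cases "lam 1 \<le> R"; simp add: n0_def)+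
  define pos where "pos n = nat (lam n - R)" for n
  have pos: "R + int (pos n) = lam n" if "n \<ge> n0" for n
    using lam_ge[OF n0(1), of "n - n0"] n0(2) that by (simp add: pos_def)

  \<comment> \<open>The multiplications by powers of the prime fill the gaps between the ratios of the f_n.\<close>
  define h where "h j = (if \<exists>n\<ge>1. lam n = j then f (SOME n. n \<ge> 1 \<and> lam n = j)
    else (\<lambda>x. prm powi (- j) * x))" for j
  have h_lam: "h (lam n) = f n" if "n \<ge> 1" for n
  proof -
    have "m = n" if "m \<ge> 1" "lam m = lam n" for m
      using mono[of m n] mono[of n m] that \<open>n \<ge> 1\<close> by (cases m n rule: linorder_cases) auto
    hence "(SOME m. m \<ge> 1 \<and> lam m = lam n) = n"
      using that by (intro some_equality) auto
    thus ?thesis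
      using that by (auto simp: h_def)
  qed
  have h_sc: "scaling_map absv q D (h j) j" for j
  proof (cases "\<exists>n\<ge>1. lam n = j")
    case True
    then obtain n where n: "n \<ge> 1" "lam n = j"
      by blast
    have "scaling_map absv q D (f n) (lam n)"
      using sc[OF n(1)] D_sub unfolding scaling_map_def by blast
    thus ?thesis
      using n h_lam by metis
  next
    case False
    have "absv (prm powi (- j) * x - prm powi (- j) * y) = real q powi j * absv (x - y)" for x y
      by (simp only: right_diff_distrib[symmetric] absv_mult absv_prm_powi minus_minus)
    thus ?thesis
      using False by (simp only: scaling_map_def powr_eq_powi h_def if_False) simp
  qed

  \<comment> \<open>This makes the share 1 - 1/L of free coordinates at least
    \<open>s\<close>.\<close>
  obtain L' :: nat where L': "1 / (1 - s) < real L'"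
    using reals_Archimedean2 by blast
  define L where "L = L' + 1"
  have "L > 0"
    by (simp add: L_def)
  have L: "1 - 1 / real L \<ge> s"
  proof -
    have "1 / (1 - s) \<le> real L"
      using L' by (simp add: L_def)
    thus ?thesis
      using \<open>s < 1\<close> \<open>L > 0\<close> by (simp add: field_simps)
  qed
  define p where "p u = pos (n0 + L * u)" for u
  have p_ge: "p u \<ge> L * u" for u
  proof -
    have "int (L * u) \<le> lam (n0 + L * u) - R"
      using lam_ge[OF n0(1), of "L * u"] n0(2) by linarith
    from nat_mono[OF this] show ?thesis
      by (simp only: p_def pos_def nat_int)
  qed
  define P where "P = range p"

  obtain \<nu> where \<nu>: "bij_betw \<nu> {0..<q} C"
    using ex_bij_betw_nat_finite[OF finite_C] card_C by auto
  obtain c1 where c1: "c1 \<in> C" "c1 \<noteq> 0"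
    using ex_nonzero_in_C by blast
  \<comment> \<open>The coordinates of the two points for one real \<open>t\<close>: the symbol
    prescribed on \<open>P\<close> depends on \<open>b\<close>, and elsewhere both carry the same
    digits of \<open>t\<close>, renamed by \<open>\<nu>\<close> as elements of
    \<open>C\<close>.\<close>
  define w where "w b t i = (if i \<in> P then (if b then 0 else c1)
    else \<nu> (base_digit q t (free_rank P i)))" for b t i
  have dig_less: "base_digit q t m < q" for t m
    by (simp add: base_digit_def nat_less_iff)
  have w_C: "w b t i \<in> C" for b t i
    using zero_in_C c1 dig_less bij_betwE[OF \<nu>] by (auto simp: w_def)
  have "\<exists>x\<in>D. \<forall>k::nat. digit0 absv q prm C (h (R + int k) x) = w b t k" for b t
    unfolding D_def by (rule ex_point_with_digits) (use h_sc w_C in \<open>auto simp: D_def\<close>)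
  then obtain \<Phi> where \<Phi>: "\<And>b t. \<Phi> b t \<in> D"
    "\<And>b t k. digit0 absv q prm C (h (R + int k) (\<Phi> b t)) = w b t k"
    by metis

  \<comment> \<open>Sharing the first \<open>k\<close> coordinates forces the floors of
    \<open>t\<close> and \<open>u\<close> to agree at scale q^m with m =
    \<open>free_rank P k\<close>, at least s k - 1. The loss of 1 is paid by the factor
    \<open>q\<close>.\<close>
  have dist_le: "\<bar>t - u\<bar> \<le> real q * real q powr (- s * real k)"
    if t: "t \<in> {0..<1}" and u: "u \<in> {0..<1}"
      and le: "absv (\<Phi> b t - \<Phi> b u) \<le> real q powi (- (R + int k))" for b t u k
  proof -
    have w_eq: "w b t i = w b u i" if "i < k" for i
      using digits_agree[of R a h, OF h_sc[unfolded D_def] \<Phi>(1)[unfolded D_def] \<Phi>(1)[unfolded D_def] le that]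
      by (simp add: \<Phi>(2))
    have "base_digit q t (free_rank P i) = base_digit q u (free_rank P i)" if "i < k" "i \<notin> P" for i
      using w_eq[OF that(1)] that(2) dig_less bij_betw_imp_inj_on[OF \<nu>]
      by (auto simp: w_def inj_on_def)
    hence "\<lfloor>t * real q ^ free_rank P k\<rfloor> = \<lfloor>u * real q ^ free_rank P k\<rfloor>"
      using t u by (intro floor_eq_if_base_digits_eq) auto
    hence "\<bar>t * real q ^ free_rank P k - u * real q ^ free_rank P k\<bar> \<le> 1"
      by linarith
    hence "\<bar>t - u\<bar> * real q ^ free_rank P k \<le> 1"
      by (simp add: abs_mult flip: left_diff_distrib)
    hence "\<bar>t - u\<bar> \<le> real q powr (- real (free_rank P k))"
      by (simp add: powr_minus powr_realpow field_simps)
    also have "\<dots> \<le> real q powr (1 - s * real k)"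
    proof (intro powr_mono)
      have "s * real k \<le> (1 - 1 / real L) * real k"
        using L by (intro mult_right_mono) auto
      thus "- real (free_rank P k) \<le> 1 - s * real k"
        using free_rank_ge[of L p k, OF \<open>L > 0\<close> p_ge] unfolding P_def by linarith
    qed simp
    also have "\<dots> = real q * real q powr (- s * real k)"
      using powr_add[of "real q" 1 "- s * real k"] by simp
    finally show ?thesis .
  qed

  \<comment> \<open>The first factor comes from \<open>dist_le\<close>; the second turns the power
    \<open>s\<close> of a distance q^(-(R + k)) into q^(-s k).\<close>
  define K where "K = real q * real q powr (s * real_of_int R)"
  show ?thesis
  proof (rule hausdorff_measure_pos)
    show "K > 0"
      unfolding K_def by (intro mult_pos_pos) simp_all
    show "\<bar>t - u\<bar> \<le> K * absv (\<Phi> b t - \<Phi> b u) powr s"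
      if t: "t \<in> {0..<1}" and u: "u \<in> {0..<1}" for b t u
    proof (cases "\<Phi> b t = \<Phi> b u")
      case True
      \<comment> \<open>Equal points satisfy \<open>dist_le\<close> for every \<open>k\<close>, so
        letting \<open>k\<close> grow gives t = u.\<close>
      have "real q powr (- s) < 1"
        using powr_less_one[of "real q" "- s"] \<open>s > 0\<close> by simp
      hence "(\<lambda>k. (real q powr (- s)) ^ k) \<longlonglongrightarrow> 0"
        by (intro LIMSEQ_power_zero) auto
      hence lim: "(\<lambda>k. real q * (real q powr (- s)) ^ k) \<longlonglongrightarrow> 0"
        by (intro tendsto_mult_right_zero)
      have "\<bar>t - u\<bar> \<le> real q * (real q powr (- s)) ^ k" for k
      proof -
        have "(real q powr (- s)) ^ k = real q powr (- s * real k)"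
          by (simp add: powr_powr flip: powr_realpow)
        thus ?thesis
          using dist_le[OF t u, of b k] True by simp
      qed
      hence "\<bar>t - u\<bar> \<le> 0"
        by (intro LIMSEQ_le_const[OF lim] exI allI impI)
      thus ?thesis
        using True by simp
    next
      case False
      then obtain i :: int where i: "absv (\<Phi> b t - \<Phi> b u) = real q powi i"
        using absv_powr[of "\<Phi> b t - \<Phi> b u"] by (auto simp: powr_eq_powi)
      have "real q powi i \<le> real q powi (- R)"
        using mem_disk_dist[of "\<Phi> b t" a _ "\<Phi> b u"] \<Phi>(1) i unfolding D_def by metis
      hence "i \<le> - R"
        using power_int_strict_increasing[of "- R" i "real q"] by (cases "i \<le> - R") auto
      define k where "k = nat (- R - i)"
      have k: "i = - (R + int k)"
        using \<open>i \<le> - R\<close> by (simp add: k_def)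
      have "absv (\<Phi> b t - \<Phi> b u) powr s = real q powr (real_of_int i * s)"
        unfolding i powr_eq_powi[symmetric] by (simp add: powr_powr)
      hence "K * absv (\<Phi> b t - \<Phi> b u) powr s = real q * (real q powr (s * real_of_int R) * real q powr (real_of_int i * s))"
        by (simp add: K_def)
      also have "\<dots> = real q * real q powr (- s * real k)"
        by (simp add: k algebra_simps flip: powr_add)
      finally show ?thesis
        using dist_le[OF t u, of b k] i k by simp
    qed
    show "\<exists>b. \<Phi> b t \<in> {x \<in> disk absv a r. \<not> ud_symbols C (\<lambda>n. digit0 absv q prm C (f n x))}" for t
    proof (rule ccontr)
      define S where "S b n = digit0 absv q prm C (f n (\<Phi> b t))" for b n
      assume "\<not> ?thesis"
      hence ud: "ud_symbols C (S b)" for b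
        using \<Phi>(1) D_sub unfolding S_def by blast
      have S: "S b n = w b t (pos n)" if "n \<ge> n0" for b n
        using \<Phi>(2)[of "pos n" b t] pos[OF that] h_lam[of n] n0(1) that by (simp add: S_def)
      show False
      proof (rule not_both_ud_symbols[OF ud[of True] ud[of False] zero_in_C \<open>L > 0\<close> n0(1)])
        \<comment> \<open>For \<open>False\<close> the prescribed symbol is \<open>c1\<close>, not
          0, so a 0 sits outside \<open>P\<close>, where the two sequences coincide.\<close>
        show "S True n = 0" if "n \<ge> n0" "S False n = 0" for n
          using that S c1 by (auto simp: w_def split: if_splits)
        have "pos (n0 + L * u) \<in> P" for u
          by (auto simp: P_def p_def)
        thus "S True (n0 + L * u) = 0" "S False (n0 + L * u) \<noteq> 0" for u
          using S c1 by (auto simp: w_def)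
      qed
    qed
  qed (use \<open>0 < s\<close> in auto)
qed

text \<open>Disks of radius 1/q centred at the elements of \<open>C\<close> suffice: by
  \<open>intpart_in_disk_iff\<close>, a visit to such a disk is an occurrence of its centre as
  digit.\<close>

lemma ud_symbols_if_ud_valring:
  assumes "ud_valring absv q (\<lambda>n. intpart absv q prm C (s n))"
  shows "ud_symbols C (\<lambda>n. digit0 absv q prm C (s n))"
  unfolding ud_symbols_def
proof
  fix c assume c: "c \<in> C"
  have powr: "real q powr (- real 1) = 1 / real q"
    by (simp add: powr_minus_divide)
  have "c \<in> valring absv"
    using C_le_1[OF c] by (simp add: valring_def)
  from assms[unfolded ud_valring_def, rule_format, OF this, of 1]
  have "(\<lambda>N. real (card {n \<in> {1..N}. intpart absv q prm C (s n) \<in> disk absv c (1 / real q)}) / real N)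
      \<longlonglongrightarrow> 1 / real q"
    unfolding powr .
  thus "(\<lambda>N. real (card {n \<in> {1..N}. digit0 absv q prm C (s n) = c}) / real N) \<longlonglongrightarrow> 1 / real (card C)"
    by (simp only: intpart_in_disk_iff[OF c] card_C)
qed

end

theorem theorem1p5:
  fixes absv :: "'a::field \<Rightarrow> real" and q :: nat and prm :: "'a" and C :: "'a set"
    and a :: 'a and r :: real and f :: "nat \<Rightarrow> 'a \<Rightarrow> 'a" and lam :: "nat \<Rightarrow> int"
  assumes "nonarch_local_field absv q prm"
    and "residue_reps absv C"
    and "r > 0"
    and "\<forall>n\<ge>1. scaling_map absv q (disk absv a r) (f n) (lam n)"
    and "\<forall>m n. 1 \<le> m \<longrightarrow> m < n \<longrightarrow> lam m < lam n"
  shows "hausdorff_dim absv {x \<in> disk absv a r.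
            \<not> ud_symbols C (\<lambda>n. digit0 absv q prm C (f n x))} = 1
     \<and> hausdorff_dim absv {x \<in> disk absv a r.
            \<not> ud_valring absv q (\<lambda>n. intpart absv q prm C (f n x))} = 1"
proof -
  interpret local_field_digits absv q prm C
    by unfold_locales (use assms(1,2) in auto)
  define E where "E = {x \<in> disk absv a r. \<not> ud_symbols C (\<lambda>n. digit0 absv q prm C (f n x))}"
  define F where "F = {x \<in> disk absv a r. \<not> ud_valring absv q (\<lambda>n. intpart absv q prm C (f n x))}"
  have "E \<subseteq> F"
    using ud_symbols_if_ud_valring by (auto simp: E_def F_def)
  have "hausdorff_measure absv s E \<noteq> 0" if "0 < s" "s < 1" for s
    unfolding E_def using assms(3-5) that by (intro hausdorff_measure_not_ud_pos) auto
  hence pos: "hausdorff_measure absv s X \<noteq> 0" if "E \<subseteq> X" "0 < s" "s < 1" for X s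
    using that hausdorff_measure_mono[OF that(1), of absv s] by (metis le_zero_eq)
  \<comment> \<open>The lower bound is inherited from \<open>E\<close> and the upper bound from the
    disk, which treats both exceptional sets at once.\<close>
  have "hausdorff_dim absv X = 1" if "E \<subseteq> X" "X \<subseteq> disk absv a r" for X
    using pos[OF that(1)] hausdorff_measure_eq_0[OF that(2)] by (rule hausdorff_dim_eq_1)
  from this[of E] this[of F] show ?thesis
    using \<open>E \<subseteq> F\<close> by (auto simp: E_def F_def)
qed

end
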